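(* Let $n\ge0$ be an integer and $r\in\mathbb{Z}$. The third-order pure-degree recurrence relations for the $2j-k$ polynomials are given by $$P_{n+3}(z;r)+\left(\frac{h^{(r-1)}_{n+2}}{h^{(r)}_{n+2}}+\frac{h^{(r-2)}_{n+1}}{h^{(r-1)}_{n+1}}\right)P_{n+2}(z;r)+\left(\frac{h^{(r-2)}_{n+1}}{h^{(r)}_{n+1}}-z^2\right)P_{n+1}(z;r)-\frac{h^{(r-2)}_{n+1}}{h^{(r)}_n}z^2P_n(z;r)=0,$$ and $$Q^*_{n+3}(z;r)-\left(1-\frac{h^{(r+2)}_{n+2}}{h^{(r)}_{n+2}}z\right)Q^*_{n+2}(z;r)-\left(\frac{h^{(r+1)}_{n+2}}{h^{(r)}_{n+1}}+\frac{h^{(r+2)}_{n+2}}{h^{(r+1)}_{n+1}}\right)zQ^*_{n+1}(z;r)-\frac{h^{(r+2)}_{n+2}}{h^{(r)}_n}z^2Q^*_n(z;r)=0,$$ or $$Q_{n+3}(z;r)-\left(z-\frac{h^{(r+2)}_{n+2}}{h^{(r)}_{n+2}}\right)Q_{n+2}(z;r)-\left(\frac{h^{(r+1)}_{n+2}}{h^{(r)}_{n+1}}+\frac{h^{(r+2)}_{n+2}}{h^{(r+1)}_{n+1}}\right)zQ_{n+1}(z;r)-\frac{h^{(r+2)}_{n+2}}{h^{(r)}_n}zQ_n(z;r)=0.$$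
   Context: $w$ is a weight function on the unit circle $\mathbb{T}$ with moments $w_\ell=\int_{\mathbb{T}} w(\zeta)\zeta^{-\ell}\frac{d\zeta}{2\pi \mathrm{i}\zeta}$, $\ell\in\mathbb{Z}$. For $t\in\mathbb{Z}$, $D^{(t)}_k:=\det(w_{2i-l+t})_{0\le i,l\le k-1}$, $D_0^{(t)}:=1$, and $h^{(t)}_k:=D^{(t)}_{k+1}/D^{(t)}_k$. The monic polynomials $P_k(z;t)$, $Q_k(z;t)$ of degree $k$ (the $2j-k$ bi-orthogonal system with offset $t$) are determined by $$\int_{\mathbb{T}}P_k(\zeta;t)Q_l(\zeta^{-2};t)\zeta^{-t}w(\zeta)\frac{d\zeta}{2\pi \mathrm{i}\zeta}=h^{(t)}_k\delta_{kl}.$$ Explicitly, when $D_k^{(t)}\ne0$: $P_k(z;t)$ is $1/D_k^{(t)}$ times the determinant of the $(k+1)\times(k+1)$ matrix with rows $(w_{t+2i},w_{t+2i-1},\dots,w_{t+2i-k})$, $0\le i\le k-1$, and last row $(1,z,\dots,z^k)$; $Q_k(z;t)$ is $1/D_k^{(t)}$ times the determinant of the $(k+1)\times(k+1)$ matrix with rows $(w_{t+2i},w_{t+2i-1},\dots,w_{t+2i-k+1},z^i)$, $0\le i\le k$. The reciprocal polynomial is $Q_k^*(z;t):=z^kQ_k(z^{-1};t)$. Standing assumption: $D^{(t)}_k\ne0$ for $0\le k\le n+3$, with $t\in\{r-2,r-1,r\}$ for the $P$-recurrence and $t\in\{r,r+1,r+2\}$ for the $Q$-recurrences. *)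

theory Defs
  imports
    "HOL-Complex_Analysis.Contour_Integration"
    "Jordan_Normal_Form.Determinant"
begin

text \<open>
  \<open>circle_mean f\<close> is the integral of \<open>f\<close> over the unit circle with respect to
  \<open>d\<zeta> / (2 \<pi> \<i> \<zeta>)\<close>.
\<close>

definition circle_mean :: "(complex \<Rightarrow> complex) \<Rightarrow> complex" where
  "circle_mean f =
     contour_integral (circlepath 0 1) (\<lambda>\<zeta>. f \<zeta> / (2 * of_real pi * \<i> * \<zeta>))"

text \<open>A weight is complex-valued and only assumed to be Lebesgue integrable on the circle.\<close>

definition circle_weight :: "(complex \<Rightarrow> complex) \<Rightarrow> bool" where
  "circle_weight w \<longleftrightarrow> (\<lambda>x. w (circlepath 0 1 x)) absolutely_integrable_on {0..1}"

definition moment :: "(complex \<Rightarrow> complex) \<Rightarrow> int \<Rightarrow> complex" where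
  "moment w l = circle_mean (\<lambda>\<zeta>. w \<zeta> * \<zeta> powi (- l))"

definition moment_det :: "(complex \<Rightarrow> complex) \<Rightarrow> int \<Rightarrow> nat \<Rightarrow> complex" where
  "moment_det w t k =
     Determinant.det (Matrix.mat k k (\<lambda>(i, l). moment w (2 * int i - int l + t)))"

lemma moment_det_0: "moment_det w t 0 = 1"
  by (simp add: moment_det_def)

definition norm_ratio :: "(complex \<Rightarrow> complex) \<Rightarrow> int \<Rightarrow> nat \<Rightarrow> complex" where
  "norm_ratio w t k = moment_det w t (k + 1) / moment_det w t k"

text \<open>
  The relations are required up to degree \<open>N\<close> only: the determinants of higher order may vanish,
  and then the system does not extend beyond degree \<open>N\<close>.
\<close>

definition biorthogonal_system ::
  "(complex \<Rightarrow> complex) \<Rightarrow> int \<Rightarrow> nat \<Rightarrow> (nat \<Rightarrow> complex poly) \<Rightarrow> (nat \<Rightarrow> complex poly) \<Rightarrow> bool"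
where
  "biorthogonal_system w t N P Q \<longleftrightarrow>
     (\<forall>k\<le>N. degree (P k) = k \<and> lead_coeff (P k) = 1 \<and> degree (Q k) = k \<and> lead_coeff (Q k) = 1) \<and>
     (\<forall>k\<le>N. \<forall>l\<le>N.
        circle_mean (\<lambda>\<zeta>. poly (P k) \<zeta> * poly (Q l) (\<zeta> powi (-2)) * \<zeta> powi (- t) * w \<zeta>)
          = (if k = l then norm_ratio w t k else 0))"

text \<open>
  Since \<open>Q k\<close> has exact degree \<open>k\<close>, its reciprocal polynomial \<open>z^k Q\<^sub>k(1/z)\<close> is
  \<open>reflect_poly (Q k)\<close>, which also covers \<open>z = 0\<close>.
\<close>

lemma reciprocal_reflect_poly:
  assumes "biorthogonal_system w t N P Q" "k \<le> N" "z \<noteq> 0"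
  shows "poly (reflect_poly (Q k)) z = z ^ k * poly (Q k) (inverse z)"
  using assms by (simp add: biorthogonal_system_def poly_reflect_poly_nz)

text \<open>
  The determinantal formulas for the two families, which show that a system exists as soon as the
  moment determinants do not vanish.
\<close>

definition det_P :: "(complex \<Rightarrow> complex) \<Rightarrow> int \<Rightarrow> nat \<Rightarrow> complex poly" where
  "det_P w t k = Polynomial.smult (1 / moment_det w t k)
     (Determinant.det (Matrix.mat (k + 1) (k + 1)
        (\<lambda>(i, l). if i < k then [:moment w (t + 2 * int i - int l):]
                  else Polynomial.monom 1 l)))"

definition det_Q :: "(complex \<Rightarrow> complex) \<Rightarrow> int \<Rightarrow> nat \<Rightarrow> complex poly" where
  "det_Q w t k = Polynomial.smult (1 / moment_det w t k)
     (Determinant.det (Matrix.mat (k + 1) (k + 1)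
        (\<lambda>(i, l). if l < k then [:moment w (t + 2 * int i - int l):]
                  else Polynomial.monom 1 i)))"

lemma circlepath_unit: "circlepath 0 1 x = exp (2 * of_real pi * \<i> * of_real x)"
  by (simp add: circlepath)

lemma circle_mean_integral: "circle_mean f = integral {0..1} (\<lambda>x. f (circlepath 0 1 x))"
  unfolding circle_mean_def contour_integral_integral
  by (rule integral_cong) (simp add: vector_derivative_circlepath circlepath_unit)

lemma circle_weight_powi:
  assumes "circle_weight w"
  shows "(\<lambda>x. w (circlepath 0 1 x) * circlepath 0 1 x powi m) integrable_on {0..1}"
proof -
  have c: "continuous_on {0..1} (\<lambda>x. circlepath 0 1 x powi m)"
    unfolding circlepath_unit by (intro continuous_intros) auto
  have "(\<lambda>x. circlepath 0 1 x powi m * w (circlepath 0 1 x)) absolutely_integrable_on {0..1}"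
  proof (rule absolutely_integrable_bounded_measurable_product
      [where h = "(*)" and g = "\<lambda>x. w (circlepath 0 1 x)"])
    show "bilinear ((*) :: complex \<Rightarrow> complex \<Rightarrow> complex)"
      by (simp add: bilinear_conv_bounded_bilinear bounded_bilinear_mult)
    show "(\<lambda>x. circlepath 0 1 x powi m) \<in> borel_measurable (lebesgue_on {0..1})"
      by (rule continuous_imp_measurable_on_sets_lebesgue[OF c]) auto
    show "bounded ((\<lambda>x. circlepath 0 1 x powi m) ` {0..1})"
      by (intro compact_imp_bounded compact_continuous_image c) auto
    show "(\<lambda>x. w (circlepath 0 1 x)) absolutely_integrable_on {0..1}"
      using assms by (simp add: circle_weight_def)
  qed auto
  then show ?thesis
    by (simp add: absolutely_integrable_on_def mult.commute)
qed

lemma circle_mean_pairing: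
  assumes w: "circle_weight w"
  shows "circle_mean (\<lambda>\<zeta>. poly p \<zeta> * poly q (\<zeta> powi (-2)) * \<zeta> powi (- t) * w \<zeta>)
    = (\<Sum>a\<le>degree p. \<Sum>b\<le>degree q. coeff p a * coeff q b * moment w (2 * int b - int a + t))"
proof -
  let ?g = "circlepath 0 1"
  have nz: "?g x \<noteq> 0" for x by (simp add: circlepath_unit)
  have eq: "poly p (?g x) * poly q (?g x powi (-2)) * ?g x powi (- t) * w (?g x)
     = (\<Sum>a\<le>degree p. \<Sum>b\<le>degree q. (coeff p a * coeff q b) *
          (w (?g x) * ?g x powi (- (2 * int b - int a + t))))" for x
  proof -
    have pw: "?g x ^ a * (?g x powi (-2)) ^ b * ?g x powi (- t)
        = ?g x powi (- (2 * int b - int a + t))" for a b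
    proof -
      have 1: "(?g x powi (-2)) ^ b = ?g x powi (- 2 * int b)"
        by (simp only: power_int_mult power_int_of_nat)
      have "?g x powi (int a + - 2 * int b + - t) = ?g x ^ a * (?g x powi (-2)) ^ b * ?g x powi (- t)"
        unfolding 1 using nz[of x]
        by (simp only: power_int_add power_int_of_nat simp_thms)
      moreover have "- (2 * int b - int a + t) = int a + - 2 * int b + - t" by simp
      ultimately show ?thesis by simp
    qed
    show ?thesis
      unfolding poly_altdef
      unfolding sum_product
      unfolding sum_distrib_right pw[symmetric]
      by (intro sum.cong refl) (simp only: mult_ac)
  qed
  show ?thesis
    unfolding circle_mean_integral eq moment_def
    by (simp add: integral_sum integrable_sum integrable_on_mult_right circle_weight_powi[OF w])
qed

definition bordered :: "(nat \<Rightarrow> nat \<Rightarrow> complex) \<Rightarrow> nat \<Rightarrow> (nat \<Rightarrow> complex) \<Rightarrow> complex mat" where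
  "bordered A k v = Matrix.mat (k + 1) (k + 1) (\<lambda>(i, l). if i < k then A i l else v l)"

definition border_poly :: "(nat \<Rightarrow> nat \<Rightarrow> complex) \<Rightarrow> nat \<Rightarrow> complex poly" where
  "border_poly A k = Determinant.det (Matrix.mat (k + 1) (k + 1)
     (\<lambda>(i, l). if i < k then [:A i l:] else Polynomial.monom 1 l))"

lemma border_poly_expand:
  "border_poly A k = (\<Sum>l<k + 1. Polynomial.monom (cofactor (bordered A k v) k l) l)"
proof -
  let ?M = "Matrix.mat (k + 1) (k + 1)
     (\<lambda>(i, l). if i < k then [:A i l:] else Polynomial.monom 1 l)"
  interpret h: comm_ring_hom "\<lambda>a :: complex. [:a:]"
    by unfold_locales (auto simp: one_pCons)
  have cof: "cofactor ?M k l = [:cofactor (bordered A k v) k l:]" if "l < k + 1" for l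
  proof -
    have "mat_delete ?M k l = map_mat (\<lambda>a. [:a:]) (mat_delete (bordered A k v) k l)"
      using that by (auto simp: mat_delete_def bordered_def intro!: eq_matI)
    then have "Determinant.det (mat_delete ?M k l)
        = [:Determinant.det (mat_delete (bordered A k v) k l):]"
      by simp
    moreover have "(-1) ^ (k + l) = [:(-1) ^ (k + l) :: complex:]"
      by (metis h.hom_one h.hom_power h.hom_uminus)
    ultimately show ?thesis by (simp add: cofactor_def)
  qed
  have "border_poly A k = (\<Sum>l<k + 1. ?M $$ (k, l) * cofactor ?M k l)"
    unfolding border_poly_def by (rule laplace_expansion_row) auto
  also have "\<dots> = (\<Sum>l<k + 1. Polynomial.monom (cofactor (bordered A k v) k l) l)"
  proof (rule sum.cong[OF refl])
    fix l assume "l \<in> {..<k + 1}"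
    then have l: "l < k + 1" by simp
    then show "?M $$ (k, l) * cofactor ?M k l = Polynomial.monom (cofactor (bordered A k v) k l) l"
      unfolding cof[OF l] by (simp add: smult_monom mult.commute[of "Polynomial.monom _ _"])
  qed
  finally show ?thesis .
qed

lemma coeff_border_poly:
  "coeff (border_poly A k) a = (if a \<le> k then cofactor (bordered A k v) k a else 0)"
  unfolding border_poly_expand[of A k v] by (auto simp: coeff_sum)

lemma border_poly_functional:
  "(\<Sum>a\<le>k. coeff (border_poly A k) a * v a) = Determinant.det (bordered A k v)"
proof -
  have "Determinant.det (bordered A k v)
      = (\<Sum>l<k + 1. bordered A k v $$ (k, l) * cofactor (bordered A k v) k l)"
    by (rule laplace_expansion_row) (auto simp: bordered_def)
  also have "\<dots> = (\<Sum>a\<le>k. coeff (border_poly A k) a * v a)"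
    by (rule sum.cong) (auto simp: coeff_border_poly[of A k _ v] bordered_def)
  finally show ?thesis by simp
qed

lemma border_poly_orthogonal:
  assumes "j < k"
  shows "(\<Sum>a\<le>k. coeff (border_poly A k) a * A j a) = 0"
  unfolding border_poly_functional
  by (rule det_identical_rows[of _ "k + 1" j k])
    (use assms in \<open>auto simp: bordered_def intro!: eq_vecI\<close>)

lemma border_poly_diagonal:
  "(\<Sum>a\<le>k. coeff (border_poly A k) a * A k a)
     = Determinant.det (Matrix.mat (k + 1) (k + 1) (\<lambda>(i, l). A i l))"
  unfolding border_poly_functional
  by (rule arg_cong[where f = Determinant.det])
    (auto simp: bordered_def intro!: eq_matI dest!: less_antisym)

lemma coeff_border_poly_top:
  "coeff (border_poly A k) k = Determinant.det (Matrix.mat k k (\<lambda>(i, l). A i l))"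
proof -
  have "mat_delete (bordered A k (\<lambda>_. 0)) k k = Matrix.mat k k (\<lambda>(i, l). A i l)"
    by (auto simp: mat_delete_def bordered_def intro!: eq_matI)
  then show ?thesis
    by (simp add: coeff_border_poly[of A k k "\<lambda>_. 0"] cofactor_def)
qed

lemma det_P_border:
  "det_P w t k = Polynomial.smult (1 / moment_det w t k)
     (border_poly (\<lambda>i l. moment w (2 * int i - int l + t)) k)"
  unfolding det_P_def border_poly_def
  by (intro arg_cong2[where f = Polynomial.smult] arg_cong[where f = Determinant.det] refl)
    (auto simp: algebra_simps intro!: eq_matI)

lemma det_Q_border:
  "det_Q w t k = Polynomial.smult (1 / moment_det w t k)
     (border_poly (\<lambda>i l. moment w (2 * int l - int i + t)) k)"
proof -
  let ?M = "Matrix.mat (k + 1) (k + 1)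
     (\<lambda>(i, l). if l < k then [:moment w (t + 2 * int i - int l):] else Polynomial.monom 1 i)"
  have "Determinant.det ?M = Determinant.det (transpose_mat ?M)"
    by (rule det_transpose[symmetric]) auto
  also have "\<dots> = border_poly (\<lambda>i l. moment w (2 * int l - int i + t)) k"
    unfolding border_poly_def
    by (rule arg_cong[where f = Determinant.det]) (auto simp: algebra_simps intro!: eq_matI)
  finally show ?thesis by (simp add: det_Q_def)
qed

lemma moment_det_transpose:
  "Determinant.det (Matrix.mat k k (\<lambda>(i, l). moment w (2 * int l - int i + t))) = moment_det w t k"
proof -
  let ?M = "Matrix.mat k k (\<lambda>(i, l). moment w (2 * int i - int l + t))"
  have "moment_det w t k = Determinant.det (transpose_mat ?M)"
    unfolding moment_det_def by (rule det_transpose[symmetric]) auto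
  also have "transpose_mat ?M = Matrix.mat k k (\<lambda>(i, l). moment w (2 * int l - int i + t))"
    by (auto intro!: eq_matI)
  finally show ?thesis by simp
qed

lemma monic_smult_border_poly:
  assumes "c = coeff (border_poly A k) k" "c \<noteq> 0"
  shows "degree (Polynomial.smult (1 / c) (border_poly A k)) = k"
    and "lead_coeff (Polynomial.smult (1 / c) (border_poly A k)) = 1"
proof -
  have le: "degree (border_poly A k) \<le> k"
    by (rule degree_le) (simp add: coeff_border_poly[of A k _ "\<lambda>_. 0"])
  have "k \<le> degree (border_poly A k)"
    using assms by (intro le_degree) simp
  with le have "degree (border_poly A k) = k" by simp
  then show "degree (Polynomial.smult (1 / c) (border_poly A k)) = k"
    and "lead_coeff (Polynomial.smult (1 / c) (border_poly A k)) = 1"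
    using assms by auto
qed

theorem det_biorthogonal_system:
  assumes w: "circle_weight w" and nz: "\<And>k. k \<le> N \<Longrightarrow> moment_det w t k \<noteq> 0"
  shows "biorthogonal_system w t N (det_P w t) (det_Q w t)"
proof -
  define A where "A = (\<lambda>i l. moment w (2 * int i - int l + t))"
  define B where "B = (\<lambda>i l. moment w (2 * int l - int i + t))"
  have AB: "A i l = B l i" for i l by (simp add: A_def B_def)
  have P: "det_P w t k = Polynomial.smult (1 / moment_det w t k) (border_poly A k)" for k
    unfolding A_def by (rule det_P_border)
  have Q: "det_Q w t k = Polynomial.smult (1 / moment_det w t k) (border_poly B k)" for k
    unfolding B_def by (rule det_Q_border)
  have topA: "moment_det w t k = coeff (border_poly A k) k" for k
    unfolding A_def by (simp only: coeff_border_poly_top moment_det_def)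
  have topB: "moment_det w t k = coeff (border_poly B k) k" for k
    unfolding B_def by (simp only: coeff_border_poly_top moment_det_transpose)
  have deg: "degree (det_P w t k) = k" "lead_coeff (det_P w t k) = 1"
      "degree (det_Q w t k) = k" "lead_coeff (det_Q w t k) = 1" if "k \<le> N" for k
    unfolding P Q
    using monic_smult_border_poly[OF topA nz[OF that]] monic_smult_border_poly[OF topB nz[OF that]]
    by auto
  have orthP: "(\<Sum>a\<le>k. coeff (det_P w t k) a * A b a) = 0" if "b < k" for b k
    using border_poly_orthogonal[OF that, of A] by (simp add: P flip: sum_divide_distrib)
  have orthQ: "(\<Sum>b\<le>l. coeff (det_Q w t l) b * A b a) = 0" if "a < l" for a l
    using border_poly_orthogonal[OF that, of B] by (simp add: Q AB flip: sum_divide_distrib)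
  have diagP: "(\<Sum>a\<le>k. coeff (det_P w t k) a * A k a) = norm_ratio w t k" for k
    using border_poly_diagonal[of A k]
    by (simp add: P norm_ratio_def A_def moment_det_def flip: sum_divide_distrib)
  have "circle_mean (\<lambda>\<zeta>. poly (det_P w t k) \<zeta> * poly (det_Q w t l) (\<zeta> powi (-2)) *
          \<zeta> powi (- t) * w \<zeta>) = (if k = l then norm_ratio w t k else 0)" (is "?I = _")
    if k: "k \<le> N" and l: "l \<le> N" for k l
  proof -
    have I1: "?I = (\<Sum>a\<le>k. \<Sum>b\<le>l. coeff (det_P w t k) a * coeff (det_Q w t l) b * A b a)"
      unfolding circle_mean_pairing[OF w] A_def deg(1)[OF k] deg(3)[OF l] ..
    then have I2: "?I = (\<Sum>b\<le>l. coeff (det_Q w t l) b * (\<Sum>a\<le>k. coeff (det_P w t k) a * A b a))"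
      by (subst (asm) sum.swap) (simp add: sum_distrib_left mult_ac)
    show ?thesis
    proof (cases "k < l")
      case True
      have "?I = (\<Sum>a\<le>k. coeff (det_P w t k) a * (\<Sum>b\<le>l. coeff (det_Q w t l) b * A b a))"
        unfolding I1 by (simp add: sum_distrib_left mult_ac)
      also have "\<dots> = 0"
        using True by (intro sum.neutral) (auto simp: orthQ)
      finally show ?thesis using True by simp
    next
      case False
      have "?I = (\<Sum>b\<le>l. if b = k then norm_ratio w t k else 0)"
        unfolding I2
      proof (rule sum.cong[OF refl])
        fix b assume "b \<in> {..l}"
        with False consider "b < k" | "b = k" "l = k" by force
        then show "coeff (det_Q w t l) b * (\<Sum>a\<le>k. coeff (det_P w t k) a * A b a)
            = (if b = k then norm_ratio w t k else 0)"
        proof cases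
          case 1
          then show ?thesis by (simp add: orthP)
        next
          case 2
          then show ?thesis using deg(3,4)[OF l] by (simp add: diagP)
        qed
      qed
      then show ?thesis using False by auto
    qed
  qed
  then show ?thesis
    unfolding biorthogonal_system_def using deg by blast
qed

end

theory Submission
  imports Defs
begin

text \<open>
  Everything comes from how the pairing
  \<open>\<langle>p, q\<rangle>\<^sub>t = \<integral> p(\<zeta>) q(\<zeta>\<^sup>-\<^sup>2) \<zeta>\<^sup>-\<^sup>t w(\<zeta>) d\<zeta> / (2 \<pi> \<i> \<zeta>)\<close>
  reacts to multiplication by the variable:
  \<open>\<langle>z p, q\<rangle>\<^sub>t = \<langle>p, q\<rangle>\<^sub>t\<^sub>-\<^sub>1\<close> and
  \<open>\<langle>p, z q\<rangle>\<^sub>t = \<langle>p, q\<rangle>\<^sub>t\<^sub>+\<^sub>2\<close>.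
  A monic polynomial of degree \<open>m + 1\<close> that is orthogonal to all polynomials of degree below \<open>m\<close> is
  a combination of the two top members of the system of offset \<open>t\<close>
  (\<open>monic_two_term_expansion\<close>). By the shift rules this applies to four polynomials taken from
  systems of neighbouring offsets, with ratios of norms as the constants \<open>c\<close>:

  \<^item> \<open>z P\<^sub>m\<close> of offset \<open>t - 1\<close> equals \<open>P\<^sub>m\<^sub>+\<^sub>1 + c P\<^sub>m\<close> of offset \<open>t\<close>;
  \<^item> \<open>P\<^sub>m\<^sub>+\<^sub>1\<close> of offset \<open>t - 2\<close> equals \<open>P\<^sub>m\<^sub>+\<^sub>1 + c P\<^sub>m\<close> of offset \<open>t\<close>;
  \<^item> \<open>z Q\<^sub>m\<close> of offset \<open>t + 2\<close> equals \<open>Q\<^sub>m\<^sub>+\<^sub>1 + c Q\<^sub>m\<close> of offset \<open>t\<close>;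
  \<^item> \<open>Q\<^sub>m\<^sub>+\<^sub>1\<close> of offset \<open>t + 1\<close> equals \<open>Q\<^sub>m\<^sub>+\<^sub>1 + c Q\<^sub>m\<close> of offset \<open>t\<close>.

  For \<open>P\<close>, the polynomial \<open>z\<^sup>2 P\<^sub>n\<^sub>+\<^sub>1\<close> of offset \<open>r - 2\<close> can
  be brought to offset \<open>r\<close> either by two steps of the first kind or by one of the second; equating
  the results is the recurrence. For \<open>Q\<close> the same is done with \<open>z Q\<^sub>n\<^sub>+\<^sub>2\<close> of offset \<open>r + 2\<close>: one
  step of the third kind against two of the fourth. The recurrence for the reciprocal
  polynomials is the one for \<open>Q\<close> under \<open>z \<mapsto> 1 / z\<close>.
\<close>

section \<open>Expansion in biorthogonal families\<close>

definition linear_functional :: "(complex poly \<Rightarrow> complex) \<Rightarrow> bool" where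
  "linear_functional L \<longleftrightarrow>
     (\<forall>p q. L (p + q) = L p + L q) \<and> (\<forall>c p. L (Polynomial.smult c p) = c * L p)"

lemma linear_functional_add: "linear_functional L \<Longrightarrow> L (p + q) = L p + L q"
  and linear_functional_smult: "linear_functional L \<Longrightarrow> L (Polynomial.smult c p) = c * L p"
  by (simp_all add: linear_functional_def)

lemma linear_functional_0: "linear_functional L \<Longrightarrow> L 0 = 0"
  using linear_functional_smult[of L 0 0] by simp

lemma linear_functional_diff: "linear_functional L \<Longrightarrow> L (p - q) = L p - L q"
  using linear_functional_add[of L "p - q" q] by simp

definition monic_of_degree :: "nat \<Rightarrow> complex poly \<Rightarrow> bool" where
  "monic_of_degree k p \<longleftrightarrow> degree p = k \<and> lead_coeff p = 1"

lemma monic_of_degree_coeff: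
  assumes "monic_of_degree k p"
  shows "coeff p k = 1" and "j > k \<Longrightarrow> coeff p j = 0"
  using assms by (auto simp: monic_of_degree_def coeff_eq_0)

lemma monic_of_degree_pCons_0: "monic_of_degree k p \<Longrightarrow> monic_of_degree (Suc k) (pCons 0 p)"
  by (auto simp: monic_of_degree_def)

text \<open>
  Monic polynomials of degrees \<open>0, \<dots>, k - 1\<close> span everything of degree below \<open>k\<close>; top
  coefficients are subtracted off one degree at a time.
\<close>

lemma linear_functional_eq_0:
  assumes L: "linear_functional L"
    and "\<And>l. l < k \<Longrightarrow> monic_of_degree l (B l)" "\<And>l. l < k \<Longrightarrow> L (B l) = 0"
    and "\<And>j. j \<ge> k \<Longrightarrow> coeff q j = 0"
  shows "L q = 0"
  using assms(2-)
proof (induction k arbitrary: q)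
  case 0
  then have "q = 0" by (simp add: poly_eq_iff)
  then show ?case by (simp add: linear_functional_0[OF L])
next
  case (Suc k)
  have "L (q - Polynomial.smult (coeff q k) (B k)) = 0"
  proof (rule Suc.IH)
    fix j assume "j \<ge> k"
    then show "coeff (q - Polynomial.smult (coeff q k) (B k)) j = 0"
      using monic_of_degree_coeff[OF Suc.prems(1)[OF lessI]] Suc.prems(3)[of j]
      by (cases "j = k") auto
  qed (use Suc.prems in auto)
  then show ?case
    by (simp add: Suc.prems linear_functional_diff[OF L] linear_functional_smult[OF L])
qed

lemma linear_functional_eq_top:
  assumes L: "linear_functional L"
    and B: "\<And>l. l \<le> k \<Longrightarrow> monic_of_degree l (B l)" and L0: "\<And>l. l < k \<Longrightarrow> L (B l) = 0"
    and q: "degree q \<le> k"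
  shows "L q = coeff q k * L (B k)"
proof -
  have "L (q - Polynomial.smult (coeff q k) (B k)) = 0"
  proof (rule linear_functional_eq_0[OF L, of k B])
    fix j assume "j \<ge> k"
    then show "coeff (q - Polynomial.smult (coeff q k) (B k)) j = 0"
      using monic_of_degree_coeff[OF B[OF order_refl]] q
      by (cases "j = k") (auto simp: coeff_eq_0)
  qed (use B L0 in auto)
  then show ?thesis
    by (simp add: linear_functional_diff[OF L] linear_functional_smult[OF L])
qed

text \<open>
  \<open>R - U\<^sub>m\<^sub>+\<^sub>1\<close> has degree at most \<open>m\<close>, and subtracting a suitable multiple of \<open>U\<^sub>m\<close> makes it
  orthogonal to \<open>V\<^sub>0, \<dots>, V\<^sub>m\<close>. A nonzero remainder \<open>D\<close> of degree \<open>k\<close> would pair with \<open>V\<^sub>k\<close> to its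
  leading coefficient times \<open>h\<^sub>k\<close>, which is not zero. The form is kept abstract so that its two
  arguments can be exchanged, which turns statements on \<open>P\<close> into statements on \<open>Q\<close>.
\<close>

lemma monic_two_term_expansion:
  assumes lin1: "\<And>v. linear_functional (\<lambda>u. F u v)"
    and U: "\<And>k. k \<le> Suc m \<Longrightarrow> monic_of_degree k (U k)"
    and orth: "\<And>k l. k \<le> Suc m \<Longrightarrow> l \<le> m \<Longrightarrow> F (U k) (V l) = (if k = l then h k else 0)"
    and h: "\<And>k. k \<le> m \<Longrightarrow> h k \<noteq> 0"
    and R: "monic_of_degree (Suc m) R" and R0: "\<And>l. l < m \<Longrightarrow> F R (V l) = 0"
  shows "R = U (Suc m) + Polynomial.smult (F R (V m) / h m) (U m)"
proof -
  define D where "D = R - U (Suc m) - Polynomial.smult (F R (V m) / h m) (U m)"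
  have "degree D \<le> m"
  proof (rule degree_le, safe)
    fix j assume "m < j"
    then show "coeff D j = 0"
      using monic_of_degree_coeff[OF R] monic_of_degree_coeff[OF U[of "Suc m"]]
        monic_of_degree_coeff[OF U[of m]]
      by (cases "j = Suc m") (auto simp: D_def)
  qed
  have FD: "F D (V l) = 0" if "l \<le> m" for l
    using that R0[of l] h[of m] orth[of "Suc m" l] orth[of m l]
    by (cases "l = m")
      (auto simp: D_def linear_functional_diff[OF lin1] linear_functional_smult[OF lin1])
  have "F D (V (degree D)) = lead_coeff D * F (U (degree D)) (V (degree D))"
    by (rule linear_functional_eq_top[OF lin1]) (use \<open>degree D \<le> m\<close> U orth in auto)
  then have "D = 0"
    using FD[OF \<open>degree D \<le> m\<close>] orth[of "degree D" "degree D"] h[of "degree D"] \<open>degree D \<le> m\<close>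
    by simp
  then show ?thesis by (simp add: D_def algebra_simps)
qed

section \<open>The pairing and its shifts\<close>

definition pairing ::
  "(complex \<Rightarrow> complex) \<Rightarrow> int \<Rightarrow> complex poly \<Rightarrow> complex poly \<Rightarrow> complex" where
  "pairing w t p q =
     circle_mean (\<lambda>\<zeta>. poly p \<zeta> * poly q (\<zeta> powi (-2)) * \<zeta> powi (- t) * w \<zeta>)"

lemma linear_functional_coeff_sum: "linear_functional (\<lambda>p. \<Sum>a\<le>degree p. coeff p a * f a)"
proof -
  have ext: "(\<Sum>a\<le>degree p. coeff p a * f a) = (\<Sum>a\<le>N. coeff p a * f a)" if "degree p \<le> N" for p N
    using that by (intro sum.mono_neutral_left) (auto simp: coeff_eq_0)
  show ?thesis
    unfolding linear_functional_def
  proof (intro conjI allI)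
    fix p q :: "complex poly" and c :: complex
    let ?N = "max (degree p) (degree q)"
    show "(\<Sum>a\<le>degree (p + q). coeff (p + q) a * f a)
        = (\<Sum>a\<le>degree p. coeff p a * f a) + (\<Sum>a\<le>degree q. coeff q a * f a)"
      unfolding ext[OF degree_add_le_max[of p q]] ext[OF max.cobounded1[of "degree p" "degree q"]]
        ext[OF max.cobounded2[of "degree q" "degree p"]]
      by (simp add: distrib_right sum.distrib)
    show "(\<Sum>a\<le>degree (Polynomial.smult c p). coeff (Polynomial.smult c p) a * f a)
        = c * (\<Sum>a\<le>degree p. coeff p a * f a)"
      by (simp add: ext[OF degree_smult_le] sum_distrib_left mult_ac)
  qed
qed

lemma linear_functional_pairing_left:
  assumes "circle_weight w"
  shows "linear_functional (\<lambda>p. pairing w t p q)"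
  using linear_functional_coeff_sum
    [of "\<lambda>a. \<Sum>b\<le>degree q. coeff q b * moment w (2 * int b - int a + t)"]
  unfolding pairing_def circle_mean_pairing[OF assms] by (simp add: sum_distrib_left mult_ac)

lemma linear_functional_pairing_right:
  assumes "circle_weight w"
  shows "linear_functional (pairing w t p)"
proof -
  have "pairing w t p = (\<lambda>q. \<Sum>b\<le>degree q. coeff q b *
      (\<Sum>a\<le>degree p. coeff p a * moment w (2 * int b - int a + t)))"
    unfolding pairing_def circle_mean_pairing[OF assms]
    by (subst sum.swap) (simp add: sum_distrib_left mult_ac)
  then show ?thesis by (simp add: linear_functional_coeff_sum)
qed

text \<open>
  The shift rules compare integrands on the circle only, because \<open>powi\<close> adds exponents only at
  nonzero arguments.
\<close>

lemma pairing_pCons_left: "pairing w t (pCons 0 p) q = pairing w (t - 1) p q"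
proof -
  have "\<zeta> * \<zeta> powi (- t) = \<zeta> powi (- (t - 1))" if "\<zeta> \<noteq> 0" for \<zeta> :: complex
    using power_int_add[of \<zeta> 1 "- t"] that by simp
  then have "circlepath 0 1 x * circlepath 0 1 x powi (- t) = circlepath 0 1 x powi (- (t - 1))" for x
    by (simp add: circlepath_unit)
  note shift = this[symmetric]
  show ?thesis
    unfolding pairing_def circle_mean_integral shift
    by (intro integral_cong) (simp add: mult_ac)
qed

lemma pairing_pCons_right: "pairing w t p (pCons 0 q) = pairing w (t + 2) p q"
proof -
  have "\<zeta> powi (-2) * \<zeta> powi (- t) = \<zeta> powi (- (t + 2))" if "\<zeta> \<noteq> 0" for \<zeta> :: complex
    using power_int_add[of \<zeta> "-2" "- t"] that by (simp only: minus_add_distrib add.commute[of "- t"]) simp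
  then have "circlepath 0 1 x powi (-2) * circlepath 0 1 x powi (- t)
      = circlepath 0 1 x powi (- (t + 2))" for x
    by (simp add: circlepath_unit)
  note shift = this[symmetric]
  show ?thesis
    unfolding pairing_def circle_mean_integral shift
    by (intro integral_cong) (simp add: mult_ac)
qed

section \<open>Biorthogonal systems with neighbouring offsets\<close>

lemma biorthogonal_system_monic:
  assumes "biorthogonal_system w t N P Q" "k \<le> N"
  shows "monic_of_degree k (P k)" and "monic_of_degree k (Q k)"
  using assms by (auto simp: biorthogonal_system_def monic_of_degree_def)

lemma biorthogonal_system_pairing:
  assumes "biorthogonal_system w t N P Q" "k \<le> N" "l \<le> N"
  shows "pairing w t (P k) (Q l) = (if k = l then norm_ratio w t k else 0)"
  using assms by (simp add: biorthogonal_system_def pairing_def)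

lemma pairing_P_top:
  assumes w: "circle_weight w" and S: "biorthogonal_system w t N P Q"
    and "k \<le> N" "degree q \<le> k"
  shows "pairing w t (P k) q = coeff q k * norm_ratio w t k"
  using linear_functional_eq_top[OF linear_functional_pairing_right[OF w, of t "P k"], of k Q q]
    biorthogonal_system_monic(2)[OF S] biorthogonal_system_pairing[OF S] assms(3,4)
  by simp

lemma pairing_Q_top:
  assumes w: "circle_weight w" and S: "biorthogonal_system w t N P Q"
    and "k \<le> N" "degree p \<le> k"
  shows "pairing w t p (Q k) = coeff p k * norm_ratio w t k"
  using linear_functional_eq_top[OF linear_functional_pairing_left[OF w, of t "Q k"], of k P p]
    biorthogonal_system_monic(1)[OF S] biorthogonal_system_pairing[OF S] assms(3,4)
  by simp

lemma norm_ratio_nonzero: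
  assumes "\<And>k. k \<le> N \<Longrightarrow> moment_det w t k \<noteq> 0" "k < N"
  shows "norm_ratio w t k \<noteq> 0"
  using assms(1)[of k] assms(1)[of "k + 1"] assms(2) by (simp add: norm_ratio_def)

lemma P_expansion:
  assumes w: "circle_weight w" and S: "biorthogonal_system w t N P Q"
    and nz: "\<And>k. k \<le> N \<Longrightarrow> moment_det w t k \<noteq> 0" and m: "m < N"
    and R: "monic_of_degree (Suc m) R" and R0: "\<And>l. l < m \<Longrightarrow> pairing w t R (Q l) = 0"
  shows "R = P (Suc m) + Polynomial.smult (pairing w t R (Q m) / norm_ratio w t m) (P m)"
  by (rule monic_two_term_expansion[OF linear_functional_pairing_left[OF w]])
    (use m R R0 biorthogonal_system_monic(1)[OF S] biorthogonal_system_pairing[OF S]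
      norm_ratio_nonzero[OF nz] in auto)

lemma Q_expansion:
  assumes w: "circle_weight w" and S: "biorthogonal_system w t N P Q"
    and nz: "\<And>k. k \<le> N \<Longrightarrow> moment_det w t k \<noteq> 0" and m: "m < N"
    and R: "monic_of_degree (Suc m) R" and R0: "\<And>l. l < m \<Longrightarrow> pairing w t (P l) R = 0"
  shows "R = Q (Suc m) + Polynomial.smult (pairing w t (P m) R / norm_ratio w t m) (Q m)"
  by (rule monic_two_term_expansion[where F = "\<lambda>q p. pairing w t p q"])
    (use m R R0 biorthogonal_system_monic(2)[OF S] biorthogonal_system_pairing[OF S]
      norm_ratio_nonzero[OF nz] linear_functional_pairing_right[OF w] in auto)

text \<open>
  In each of the four connection formulas, a shift rule moves the pairing with the \<open>l\<close>-th dual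
  polynomial to the other offset, where the polynomial at hand is a member of its own system; the
  result is the coefficient of \<open>z\<^sup>m\<close> in that dual polynomial times a norm, which vanishes for
  \<open>l < m\<close> and is the norm itself for \<open>l = m\<close>.
\<close>

lemma z_times_P_connection:
  assumes w: "circle_weight w" and S: "biorthogonal_system w t N P Q"
    and S': "biorthogonal_system w (t - 1) N P' Q'"
    and nz: "\<And>k. k \<le> N \<Longrightarrow> moment_det w t k \<noteq> 0" and m: "m < N"
  shows "pCons 0 (P' m)
    = P (Suc m) + Polynomial.smult (norm_ratio w (t - 1) m / norm_ratio w t m) (P m)"
proof -
  have pr: "pairing w t (pCons 0 (P' m)) (Q l) = coeff (Q l) m * norm_ratio w (t - 1) m"
    if "l \<le> m" for l
    using pairing_P_top[OF w S', of m "Q l"] biorthogonal_system_monic(2)[OF S, of l] m that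
    by (simp add: pairing_pCons_left monic_of_degree_def)
  have Q: "coeff (Q l) m = (if l = m then 1 else 0)" if "l \<le> m" for l
    using monic_of_degree_coeff[OF biorthogonal_system_monic(2)[OF S, of l]] m that by auto
  show ?thesis
    using P_expansion[OF w S nz m monic_of_degree_pCons_0[OF biorthogonal_system_monic(1)[OF S']]]
      pr Q m by simp
qed

lemma P_connection:
  assumes w: "circle_weight w" and S: "biorthogonal_system w t N P Q"
    and S': "biorthogonal_system w (t - 2) N P' Q'"
    and nz: "\<And>k. k \<le> N \<Longrightarrow> moment_det w t k \<noteq> 0" and m: "m < N"
  shows "P' (Suc m)
    = P (Suc m) + Polynomial.smult (norm_ratio w (t - 2) (Suc m) / norm_ratio w t m) (P m)"
proof -
  have pr: "pairing w t (P' (Suc m)) (Q l) = coeff (Q l) m * norm_ratio w (t - 2) (Suc m)"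
    if "l \<le> m" for l
    using pairing_P_top[OF w S', of "Suc m" "pCons 0 (Q l)"]
      biorthogonal_system_monic(2)[OF S, of l] m that
    by (simp add: pairing_pCons_right monic_of_degree_def)
  have Q: "coeff (Q l) m = (if l = m then 1 else 0)" if "l \<le> m" for l
    using monic_of_degree_coeff[OF biorthogonal_system_monic(2)[OF S, of l]] m that by auto
  show ?thesis
    using P_expansion[OF w S nz m biorthogonal_system_monic(1)[OF S']] pr Q m by simp
qed

lemma z_times_Q_connection:
  assumes w: "circle_weight w" and S: "biorthogonal_system w t N P Q"
    and S': "biorthogonal_system w (t + 2) N P' Q'"
    and nz: "\<And>k. k \<le> N \<Longrightarrow> moment_det w t k \<noteq> 0" and m: "m < N"
  shows "pCons 0 (Q' m)
    = Q (Suc m) + Polynomial.smult (norm_ratio w (t + 2) m / norm_ratio w t m) (Q m)"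
proof -
  have pr: "pairing w t (P l) (pCons 0 (Q' m)) = coeff (P l) m * norm_ratio w (t + 2) m"
    if "l \<le> m" for l
    using pairing_Q_top[OF w S', of m "P l"] biorthogonal_system_monic(1)[OF S, of l] m that
    by (simp add: pairing_pCons_right monic_of_degree_def)
  have P: "coeff (P l) m = (if l = m then 1 else 0)" if "l \<le> m" for l
    using monic_of_degree_coeff[OF biorthogonal_system_monic(1)[OF S, of l]] m that by auto
  show ?thesis
    using Q_expansion[OF w S nz m monic_of_degree_pCons_0[OF biorthogonal_system_monic(2)[OF S']]]
      pr P m by simp
qed

lemma Q_connection:
  assumes w: "circle_weight w" and S: "biorthogonal_system w t N P Q"
    and S': "biorthogonal_system w (t + 1) N P' Q'"
    and nz: "\<And>k. k \<le> N \<Longrightarrow> moment_det w t k \<noteq> 0" and m: "m < N"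
  shows "Q' (Suc m)
    = Q (Suc m) + Polynomial.smult (norm_ratio w (t + 1) (Suc m) / norm_ratio w t m) (Q m)"
proof -
  have pr: "pairing w t (P l) (Q' (Suc m)) = coeff (P l) m * norm_ratio w (t + 1) (Suc m)"
    if "l \<le> m" for l
    using pairing_Q_top[OF w S', of "Suc m" "pCons 0 (P l)"]
      biorthogonal_system_monic(1)[OF S, of l] m that
    by (simp add: pairing_pCons_left monic_of_degree_def)
  have P: "coeff (P l) m = (if l = m then 1 else 0)" if "l \<le> m" for l
    using monic_of_degree_coeff[OF biorthogonal_system_monic(1)[OF S, of l]] m that by auto
  show ?thesis
    using Q_expansion[OF w S nz m biorthogonal_system_monic(2)[OF S']] pr P m by simp
qed

section \<open>The third-order recurrences\<close>

lemma P_recurrence: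
  fixes r :: int
  assumes w: "circle_weight w" and S: "biorthogonal_system w r (n + 3) P Q"
    and nz: "\<And>t k. t \<in> {r - 2, r - 1, r} \<Longrightarrow> k \<le> n + 3 \<Longrightarrow> moment_det w t k \<noteq> 0"
  shows "poly (P (n + 3)) z
      + (norm_ratio w (r - 1) (n + 2) / norm_ratio w r (n + 2)
         + norm_ratio w (r - 2) (n + 1) / norm_ratio w (r - 1) (n + 1)) * poly (P (n + 2)) z
      + (norm_ratio w (r - 2) (n + 1) / norm_ratio w r (n + 1) - z\<^sup>2) * poly (P (n + 1)) z
      - norm_ratio w (r - 2) (n + 1) / norm_ratio w r n * z\<^sup>2 * poly (P n) z = 0"
proof -
  note nz' = nz[OF insertI1] nz[OF insertI2[OF insertI1]] nz[OF insertI2[OF insertI2[OF insertI1]]]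
  have S1: "biorthogonal_system w (r - 1) (n + 3) (det_P w (r - 1)) (det_Q w (r - 1))"
    and S2: "biorthogonal_system w (r - 2) (n + 3) (det_P w (r - 2)) (det_Q w (r - 2))"
    using det_biorthogonal_system[OF w nz'(2)] det_biorthogonal_system[OF w nz'(1)] by auto
  have S2': "biorthogonal_system w (r - 1 - 1) (n + 3) (det_P w (r - 2)) (det_Q w (r - 2))"
    using S2 by simp
  define A where "A k = poly (det_P w (r - 1) k) z" for k
  define B where "B = poly (det_P w (r - 2) (n + 1)) z"
  define h0 h1 h2 where "h0 = norm_ratio w r" and "h1 = norm_ratio w (r - 1)"
    and "h2 = norm_ratio w (r - 2)"
  define p where "p k = poly (P k) z" for k
  have up: "z * A m = p (Suc m) + h1 m / h0 m * p m" if "m < n + 3" for m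
    using arg_cong[OF z_times_P_connection[OF w S S1 nz'(3) that], of "\<lambda>q. poly q z"]
    by (simp add: A_def p_def h0_def h1_def)
  have up2: "z * B = A (n + 2) + h2 (n + 1) / h1 (n + 1) * A (n + 1)"
    using arg_cong[OF z_times_P_connection[OF w S1 S2' nz'(2), of "n + 1"], of "\<lambda>q. poly q z"]
    by (simp add: A_def B_def h1_def h2_def)
  have down: "B = p (n + 1) + h2 (n + 1) / h0 n * p n"
    using arg_cong[OF P_connection[OF w S S2 nz'(3), of n], of "\<lambda>q. poly q z"]
    by (simp add: B_def p_def h0_def h2_def)
  have h1: "h1 (n + 1) \<noteq> 0"
    unfolding h1_def by (rule norm_ratio_nonzero[OF nz'(2), of "n + 3"]) auto
  have "z\<^sup>2 * B = z * A (n + 2) + h2 (n + 1) / h1 (n + 1) * (z * A (n + 1))"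
    using arg_cong[OF up2, of "(*) z"] by (simp add: power2_eq_square algebra_simps)
  also have "\<dots> = p (n + 3) + h1 (n + 2) / h0 (n + 2) * p (n + 2)
      + h2 (n + 1) / h1 (n + 1) * (p (n + 2) + h1 (n + 1) / h0 (n + 1) * p (n + 1))"
    using up[of "n + 2"] up[of "n + 1"] by (simp add: eval_nat_numeral)
  also have "\<dots> = p (n + 3) + (h1 (n + 2) / h0 (n + 2) + h2 (n + 1) / h1 (n + 1)) * p (n + 2)
      + h2 (n + 1) / h0 (n + 1) * p (n + 1)"
    using h1 by (simp add: algebra_simps)
  finally have "p (n + 3) + (h1 (n + 2) / h0 (n + 2) + h2 (n + 1) / h1 (n + 1)) * p (n + 2)
      + (h2 (n + 1) / h0 (n + 1) - z\<^sup>2) * p (n + 1) - h2 (n + 1) / h0 n * z\<^sup>2 * p n = 0"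
    unfolding down by (simp add: algebra_simps)
  then show ?thesis by (simp add: p_def h0_def h1_def h2_def)
qed

lemma Q_recurrence:
  fixes r :: int
  assumes w: "circle_weight w" and S: "biorthogonal_system w r (n + 3) P Q"
    and nz: "\<And>t k. t \<in> {r, r + 1, r + 2} \<Longrightarrow> k \<le> n + 3 \<Longrightarrow> moment_det w t k \<noteq> 0"
  shows "poly (Q (n + 3)) z
      - (z - norm_ratio w (r + 2) (n + 2) / norm_ratio w r (n + 2)) * poly (Q (n + 2)) z
      - (norm_ratio w (r + 1) (n + 2) / norm_ratio w r (n + 1)
         + norm_ratio w (r + 2) (n + 2) / norm_ratio w (r + 1) (n + 1)) * z * poly (Q (n + 1)) z
      - norm_ratio w (r + 2) (n + 2) / norm_ratio w r n * z * poly (Q n) z = 0"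
proof -
  note nz' = nz[OF insertI1] nz[OF insertI2[OF insertI1]] nz[OF insertI2[OF insertI2[OF insertI1]]]
  have S1: "biorthogonal_system w (r + 1) (n + 3) (det_P w (r + 1)) (det_Q w (r + 1))"
    and S2: "biorthogonal_system w (r + 2) (n + 3) (det_P w (r + 2)) (det_Q w (r + 2))"
    using det_biorthogonal_system[OF w nz'(2)] det_biorthogonal_system[OF w nz'(3)] by auto
  have S2': "biorthogonal_system w (r + 1 + 1) (n + 3) (det_P w (r + 2)) (det_Q w (r + 2))"
    using S2 by (simp add: add.assoc)
  define A where "A k = poly (det_Q w (r + 1) k) z" for k
  define B where "B = poly (det_Q w (r + 2) (n + 2)) z"
  define h0 h1 h2 where "h0 = norm_ratio w r" and "h1 = norm_ratio w (r + 1)"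
    and "h2 = norm_ratio w (r + 2)"
  define q where "q k = poly (Q k) z" for k
  have up: "z * B = q (n + 3) + h2 (n + 2) / h0 (n + 2) * q (n + 2)"
    using arg_cong[OF z_times_Q_connection[OF w S S2 nz'(1), of "n + 2"], of "\<lambda>q. poly q z"]
    by (simp add: B_def q_def h0_def h2_def eval_nat_numeral)
  have down: "A (Suc m) = q (Suc m) + h1 (Suc m) / h0 m * q m" if "m < n + 3" for m
    using arg_cong[OF Q_connection[OF w S S1 nz'(1) that], of "\<lambda>q. poly q z"]
    by (simp add: A_def q_def h0_def h1_def)
  have down2: "B = A (n + 2) + h2 (n + 2) / h1 (n + 1) * A (n + 1)"
    using arg_cong[OF Q_connection[OF w S1 S2' nz'(2), of "n + 1"], of "\<lambda>q. poly q z"]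
    by (simp add: A_def B_def h1_def h2_def add.assoc)
  have h1: "h1 (n + 1) \<noteq> 0"
    unfolding h1_def by (rule norm_ratio_nonzero[OF nz'(2), of "n + 3"]) auto
  have "B = q (n + 2) + h1 (n + 2) / h0 (n + 1) * q (n + 1)
      + h2 (n + 2) / h1 (n + 1) * (q (n + 1) + h1 (n + 1) / h0 n * q n)"
    using down2 down[of "n + 1"] down[of n] by simp
  also have "\<dots> = q (n + 2) + (h1 (n + 2) / h0 (n + 1) + h2 (n + 2) / h1 (n + 1)) * q (n + 1)
      + h2 (n + 2) / h0 n * q n"
    using h1 by (simp add: algebra_simps)
  finally have B: "B = \<dots>" .
  have "q (n + 3) - (z - h2 (n + 2) / h0 (n + 2)) * q (n + 2)
      - (h1 (n + 2) / h0 (n + 1) + h2 (n + 2) / h1 (n + 1)) * z * q (n + 1)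
      - h2 (n + 2) / h0 n * z * q n = 0"
    using up unfolding B by (simp add: algebra_simps)
  then show ?thesis by (simp add: q_def h0_def h1_def h2_def)
qed

text \<open>
  Away from the origin this is the recurrence at \<open>1 / z\<close> multiplied by \<open>z\<^sup>n\<^sup>+\<^sup>3\<close>; at the origin
  only the leading coefficients of the two highest polynomials remain, and they cancel.
\<close>

lemma reflect_recurrence:
  fixes a b c z :: complex
  assumes Q: "\<And>k. k \<le> n + 3 \<Longrightarrow> monic_of_degree k (Q k)"
    and rec: "\<And>x. poly (Q (n + 3)) x - (x - a) * poly (Q (n + 2)) x
      - b * x * poly (Q (n + 1)) x - c * x * poly (Q n) x = 0"
  shows "poly (reflect_poly (Q (n + 3))) z - (1 - a * z) * poly (reflect_poly (Q (n + 2))) z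
    - b * z * poly (reflect_poly (Q (n + 1))) z - c * z\<^sup>2 * poly (reflect_poly (Q n)) z = 0"
proof (cases "z = 0")
  case True
  have "poly (reflect_poly (Q k)) 0 = 1" if "k \<le> n + 3" for k
    using Q[OF that] by (auto simp: poly_0_coeff_0 monic_of_degree_def)
  then show ?thesis using True by simp
next
  case False
  define x where "x = inverse z"
  have zx: "z * x = 1" using False by (simp add: x_def)
  have rp: "poly (reflect_poly (Q k)) z = z ^ k * poly (Q k) x" if "k \<le> n + 3" for k
    using Q[OF that] False by (simp add: poly_reflect_poly_nz x_def monic_of_degree_def)
  have "z ^ (n + 3) * (poly (Q (n + 3)) x - (x - a) * poly (Q (n + 2)) x
      - b * x * poly (Q (n + 1)) x - c * x * poly (Q n) x)
    = z ^ (n + 3) * poly (Q (n + 3)) x - (z * x - a * z) * (z ^ (n + 2) * poly (Q (n + 2)) x)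
      - b * z * (z * x) * (z ^ (n + 1) * poly (Q (n + 1)) x)
      - c * z\<^sup>2 * (z * x) * (z ^ n * poly (Q n) x)"
    by (simp add: eval_nat_numeral algebra_simps)
  then show ?thesis
    unfolding rec zx by (simp add: rp)
qed

theorem proposition2:
  fixes w :: "complex \<Rightarrow> complex" and n :: nat and r :: int
    and P Q :: "nat \<Rightarrow> complex poly"
  assumes weight: "circle_weight w"
    and system: "biorthogonal_system w r (n + 3) P Q"
  shows
    "((\<forall>t\<in>{r - 2, r - 1, r}. \<forall>k\<le>n + 3. moment_det w t k \<noteq> 0) \<longrightarrow>
       (\<forall>z.
          poly (P (n + 3)) z
          + (norm_ratio w (r - 1) (n + 2) / norm_ratio w r (n + 2)
             + norm_ratio w (r - 2) (n + 1) / norm_ratio w (r - 1) (n + 1)) * poly (P (n + 2)) z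
          + (norm_ratio w (r - 2) (n + 1) / norm_ratio w r (n + 1) - z\<^sup>2) * poly (P (n + 1)) z
          - norm_ratio w (r - 2) (n + 1) / norm_ratio w r n * z\<^sup>2 * poly (P n) z = 0))
     \<and>
     ((\<forall>t\<in>{r, r + 1, r + 2}. \<forall>k\<le>n + 3. moment_det w t k \<noteq> 0) \<longrightarrow>
       (\<forall>z.
          poly (reflect_poly (Q (n + 3))) z
          - (1 - norm_ratio w (r + 2) (n + 2) / norm_ratio w r (n + 2) * z)
            * poly (reflect_poly (Q (n + 2))) z
          - (norm_ratio w (r + 1) (n + 2) / norm_ratio w r (n + 1)
             + norm_ratio w (r + 2) (n + 2) / norm_ratio w (r + 1) (n + 1))
            * z * poly (reflect_poly (Q (n + 1))) z
          - norm_ratio w (r + 2) (n + 2) / norm_ratio w r n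
            * z\<^sup>2 * poly (reflect_poly (Q n)) z = 0)
       \<and>
       (\<forall>z.
          poly (Q (n + 3)) z
          - (z - norm_ratio w (r + 2) (n + 2) / norm_ratio w r (n + 2)) * poly (Q (n + 2)) z
          - (norm_ratio w (r + 1) (n + 2) / norm_ratio w r (n + 1)
             + norm_ratio w (r + 2) (n + 2) / norm_ratio w (r + 1) (n + 1))
            * z * poly (Q (n + 1)) z
          - norm_ratio w (r + 2) (n + 2) / norm_ratio w r n * z * poly (Q n) z = 0))"
proof (intro conjI impI allI)
  fix z
  assume "\<forall>t\<in>{r - 2, r - 1, r}. \<forall>k\<le>n + 3. moment_det w t k \<noteq> 0"
  then show "poly (P (n + 3)) z
      + (norm_ratio w (r - 1) (n + 2) / norm_ratio w r (n + 2)
         + norm_ratio w (r - 2) (n + 1) / norm_ratio w (r - 1) (n + 1)) * poly (P (n + 2)) z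
      + (norm_ratio w (r - 2) (n + 1) / norm_ratio w r (n + 1) - z\<^sup>2) * poly (P (n + 1)) z
      - norm_ratio w (r - 2) (n + 1) / norm_ratio w r n * z\<^sup>2 * poly (P n) z = 0"
    by (intro P_recurrence[OF weight system]) blast
next
  assume "\<forall>t\<in>{r, r + 1, r + 2}. \<forall>k\<le>n + 3. moment_det w t k \<noteq> 0"
  then have nz: "\<And>t k. t \<in> {r, r + 1, r + 2} \<Longrightarrow> k \<le> n + 3 \<Longrightarrow> moment_det w t k \<noteq> 0"
    by blast
  note rec = Q_recurrence[OF weight system nz]
  show "poly (Q (n + 3)) z
      - (z - norm_ratio w (r + 2) (n + 2) / norm_ratio w r (n + 2)) * poly (Q (n + 2)) z
      - (norm_ratio w (r + 1) (n + 2) / norm_ratio w r (n + 1)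
         + norm_ratio w (r + 2) (n + 2) / norm_ratio w (r + 1) (n + 1))
        * z * poly (Q (n + 1)) z
      - norm_ratio w (r + 2) (n + 2) / norm_ratio w r n * z * poly (Q n) z = 0" for z
    by (rule rec)
  show "poly (reflect_poly (Q (n + 3))) z
      - (1 - norm_ratio w (r + 2) (n + 2) / norm_ratio w r (n + 2) * z)
        * poly (reflect_poly (Q (n + 2))) z
      - (norm_ratio w (r + 1) (n + 2) / norm_ratio w r (n + 1)
         + norm_ratio w (r + 2) (n + 2) / norm_ratio w (r + 1) (n + 1))
        * z * poly (reflect_poly (Q (n + 1))) z
      - norm_ratio w (r + 2) (n + 2) / norm_ratio w r n
        * z\<^sup>2 * poly (reflect_poly (Q n)) z = 0" for z
    by (rule reflect_recurrence[OF biorthogonal_system_monic(2)[OF system] rec])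
qed

end
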